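(* Let $V$ be an $n$-dimensional vector space over a finite field $\mathbb{F}$ and let $U$ be an $r$-dimensional subspace of $V$ with $U\neq V$. Let $L_{GL(U)}(V)=\{\alpha\in L(V):\alpha|_U\in GL(U)\}$ and, for $0\le k\le n-r$, let $J(k)=\{\alpha\in L_{GL(U)}(V):\dim(V\alpha/U)=k\}$. Let $\alpha\in J(n-r-1)$. Then \[ L_{GL(U)}(V)=\langle J(n-r)\cup\{\alpha\}\rangle . \] Consequently, $\mathrm{rank}(L_{GL(U)}(V))\leq\mathrm{rank}(J(n-r))+1$.
   Context: $L(V)$ is the semigroup of all linear maps $V\to V$ under composition; maps are written on the right and composed from left to right, and $V\alpha$ is the range of $\alpha$. $GL(U)$ is the group of all bijective linear maps $U\to U$; $\alpha|_U\in GL(U)$ means that $\alpha$ restricts to a bijection of $U$ onto $U$ (so $U\subseteq V\alpha$). For a subset $G$ of a semigroup $S$, $\langle G\rangle$ is the subsemigroup of all finite (nonempty) products of elements of $G$; $\mathrm{rank}(S)=\min\{|G|:G\subseteq S,\ S=\langle G\rangle\}$. Here $J(n-r)$ is a subsemigroup of $L_{GL(U)}(V)$. *)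

theory Defs
  imports Complex_Main "HOL-Library.Set_Algebras"
begin

text \<open>
  The vector space \<open>V\<close> is the whole type \<open>'v\<close>, with scalar multiplication
  \<open>scale :: 'f \<Rightarrow> 'v \<Rightarrow> 'v\<close> as in \<^locale>\<open>vector_space\<close>.
\<close>

subsection \<open>Quotient spaces and their dimension\<close>

definition quotient_space :: "'v::ab_group_add set \<Rightarrow> 'v set \<Rightarrow> 'v set set" where
  "quotient_space W U = (\<lambda>w. w +o U) ` W"

text \<open>
  The linear combination of a finite set \<open>C\<close> of cosets of \<open>U\<close> with coefficients \<open>f\<close>, computed
  elementwise: sums of cosets are sums of sets. Since \<open>scale 0 ` A = {0}\<close> (and the empty sum of
  sets is \<open>{0}\<close>), the outer summand \<open>U\<close> is what makes the result a coset of \<open>U\<close> in all cases.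
\<close>
definition quotient_lincomb ::
    "('f \<Rightarrow> 'v \<Rightarrow> 'v) \<Rightarrow> 'v set \<Rightarrow> ('v set \<Rightarrow> 'f) \<Rightarrow> 'v set set \<Rightarrow> 'v::ab_group_add set" where
  "quotient_lincomb scale U f C = U + (\<Sum>A\<in>C. scale (f A) ` A)"

definition quotient_basis ::
    "('f::field \<Rightarrow> 'v \<Rightarrow> 'v) \<Rightarrow> 'v::ab_group_add set \<Rightarrow> 'v set \<Rightarrow> 'v set set \<Rightarrow> bool" where
  "quotient_basis scale W U C \<longleftrightarrow>
     finite C \<and> C \<subseteq> quotient_space W U \<and>
     (\<forall>f. quotient_lincomb scale U f C = U \<longrightarrow> (\<forall>A\<in>C. f A = 0)) \<and>
     (\<forall>A\<in>quotient_space W U. \<exists>f. A = quotient_lincomb scale U f C)"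

text \<open>
  Meaningful for subspaces \<open>U \<subseteq> W\<close> with \<open>W/U\<close> finite-dimensional, where a basis exists and its
  cardinality does not depend on the choice.
\<close>
definition quotient_dim ::
    "('f::field \<Rightarrow> 'v \<Rightarrow> 'v) \<Rightarrow> 'v::ab_group_add set \<Rightarrow> 'v set \<Rightarrow> nat" where
  "quotient_dim scale W U = card (SOME C. quotient_basis scale W U C)"

subsection \<open>Generation and rank in semigroups\<close>

text \<open>Here \<open>m\<close> is the multiplication of the semigroup.\<close>

definition sg_generated :: "('a \<Rightarrow> 'a \<Rightarrow> 'a) \<Rightarrow> 'a set \<Rightarrow> 'a set" where
  "sg_generated m G = {foldl m g gs | g gs. g \<in> G \<and> set gs \<subseteq> G}"

text \<open>For finitely generated \<open>S\<close>, in particular for finite \<open>S\<close>, this is the minimum of \<open>|G|\<close>.\<close>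
definition sg_rank :: "('a \<Rightarrow> 'a \<Rightarrow> 'a) \<Rightarrow> 'a set \<Rightarrow> nat" where
  "sg_rank m S = (LEAST k. \<exists>G\<subseteq>S. finite G \<and> card G = k \<and> S = sg_generated m G)"

subsection \<open>The semigroup of linear maps that are bijective on a subspace\<close>

text \<open>Maps act on the right, so the product \<open>\<alpha>\<beta>\<close> applies \<open>\<alpha>\<close> first.\<close>
definition map_mult :: "('v \<Rightarrow> 'v) \<Rightarrow> ('v \<Rightarrow> 'v) \<Rightarrow> 'v \<Rightarrow> 'v" where
  "map_mult \<alpha> \<beta> = \<beta> \<circ> \<alpha>"

definition L_GL :: "('f::field \<Rightarrow> 'v \<Rightarrow> 'v) \<Rightarrow> 'v::ab_group_add set \<Rightarrow> ('v \<Rightarrow> 'v) set" where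
  "L_GL scale U = {\<alpha>. Vector_Spaces.linear scale scale \<alpha> \<and> bij_betw \<alpha> U U}"

definition J :: "('f::field \<Rightarrow> 'v \<Rightarrow> 'v) \<Rightarrow> 'v::ab_group_add set \<Rightarrow> nat \<Rightarrow> ('v \<Rightarrow> 'v) set" where
  "J scale U k = {\<alpha> \<in> L_GL scale U. quotient_dim scale (range \<alpha>) U = k}"

end

theory Submission
  imports Defs
begin

text \<open>
  Since \<open>dim (W/U) = dim W - dim U\<close>, the set \<open>J(n - r)\<close> is the group of units of the monoid
  \<open>L\<^bsub>GL(U)\<^esub>(V)\<close>, and the elements of \<open>J(n - r - 1)\<close> are those whose range is a hyperplane. Let
  \<open>\<beta>\<close> be singular with kernel vector \<open>k\<close>, and let \<open>a\<close> be a kernel vector of \<open>\<alpha>\<close>; neither lies in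
  \<open>U\<close>. Choose a functional \<open>\<phi>\<close> vanishing on \<open>U\<close> with \<open>\<phi>(k) = 1\<close> and \<open>\<phi>(a) \<noteq> 0\<close>, and let \<open>e\<^sub>x\<close> be
  the projection \<open>v - (\<phi>(v)/\<phi>(x)) x\<close> for \<open>x \<in> {k, a}\<close>. Applying \<open>e\<^sub>k\<close> first and then
  \<open>\<gamma> = \<beta> + \<phi> d\<close> with \<open>d\<close> outside the range of \<open>\<beta>\<close> gives \<open>\<beta>\<close>, and \<open>\<gamma>\<close> has a larger range.
  In the same way \<open>\<alpha>\<close> is \<open>e\<^sub>a\<close> followed by a unit, while \<open>e\<^sub>k\<close> is the unit
  \<open>v + \<phi>(v) (a - k)\<close> followed by \<open>e\<^sub>a\<close>. Hence \<open>\<beta>\<close> is a product of units, \<open>\<alpha>\<close> and \<open>\<gamma>\<close>, and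
  induction on the size of the range finishes the argument.
\<close>

section \<open>Dimension of quotient spaces\<close>

text \<open>Scaling turns the coset of \<open>a\<close> into \<open>c a + cU\<close> with
  \<open>cU\<close> inside \<open>U\<close>, and adding \<open>U\<close> fills this up to a full
  coset. This covers \<open>c = 0\<close>, where the scaled image is only
  \<open>{0}\<close>.\<close>

lemma (in module) subspace_plus_self:
  assumes "subspace U"
  shows "scale c ` (a +o U) + U = (c *s a) +o U"
proof
  show "scale c ` (a +o U) + U \<subseteq> (c *s a) +o U"
    using assms
    by (auto simp: set_plus_def elt_set_plus_def scale_right_distrib add.assoc
        intro!: subspace_add subspace_scale)
  show "(c *s a) +o U \<subseteq> scale c ` (a +o U) + U"
  proof
    fix x assume "x \<in> (c *s a) +o U"
    then obtain u where u: "u \<in> U" "x = c *s a + u" by (auto simp: elt_set_plus_def)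
    have "a \<in> a +o U" using assms by (auto simp: elt_set_plus_def subspace_0 intro!: bexI[of _ 0])
    then show "x \<in> scale c ` (a +o U) + U" unfolding u(2) using u(1) by blast
  qed
qed

text \<open>The outer summand \<open>U\<close> is passed along the induction: each new scaled coset
  absorbs it and hands back a full coset.\<close>

lemma (in module) plus_sum_scaled_cosets:
  assumes "subspace U" "finite R"
  shows "U + (\<Sum>b\<in>R. scale (c b) ` (b +o U)) = (\<Sum>b\<in>R. c b *s b) +o U"
  using assms(2)
proof induction
  case empty
  then show ?case by (simp add: set_zero)
next
  case (insert a R)
  let ?S = "\<Sum>b\<in>R. scale (c b) ` (b +o U)"
  let ?X = "scale (c a) ` (a +o U)"
  have "U + (\<Sum>b\<in>insert a R. scale (c b) ` (b +o U)) = (U + ?S) + ?X"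
    using insert.hyps by (simp add: ac_simps)
  also have "\<dots> = ((\<Sum>b\<in>R. c b *s b) +o U) + ?X" by (simp only: insert.IH)
  also have "\<dots> = (\<Sum>b\<in>R. c b *s b) +o (?X + U)"
    by (simp only: set_plus_rearrange3 add.commute[of U])
  also have "\<dots> = (\<Sum>b\<in>R. c b *s b) +o ((c a *s a) +o U)"
    by (simp only: subspace_plus_self[OF assms(1)])
  also have "\<dots> = (\<Sum>b\<in>insert a R. c b *s b) +o U"
    using insert.hyps by (simp add: set_plus_rearrange2 add.commute)
  finally show ?case .
qed

lemma (in module) quotient_lincomb_cosets:
  assumes "subspace U" "finite R" "inj_on (\<lambda>b. b +o U) R"
  shows "quotient_lincomb scale U f ((\<lambda>b. b +o U) ` R) = (\<Sum>b\<in>R. f (b +o U) *s b) +o U"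
  unfolding quotient_lincomb_def
  by (simp add: sum.reindex[OF assms(3)] plus_sum_scaled_cosets[OF assms(1,2)])

lemma (in module) coset_eq_iff:
  assumes "subspace U"
  shows "a +o U = b +o U \<longleftrightarrow> a - b \<in> U"
proof
  have "0 \<in> U" using assms by (rule subspace_0)
  assume "a +o U = b +o U"
  moreover have "a \<in> a +o U" using \<open>0 \<in> U\<close> by (force simp: elt_set_plus_def)
  ultimately show "a - b \<in> U" by (auto intro: set_plus_imp_minus)
next
  have sub: "a +o U \<subseteq> b +o U" if "a - b \<in> U" for a b
  proof
    fix x assume "x \<in> a +o U"
    then obtain u where "u \<in> U" "x = a + u" by (auto simp: elt_set_plus_def)
    then have "x = b + ((a - b) + u)" "(a - b) + u \<in> U"
      using that assms by (auto intro: subspace_add)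
    then show "x \<in> b +o U" unfolding elt_set_plus_def by blast
  qed
  assume "a - b \<in> U"
  moreover have "b - a \<in> U" using subspace_neg[OF assms \<open>a - b \<in> U\<close>] by simp
  ultimately show "a +o U = b +o U" using sub by blast
qed

context finite_dimensional_vector_space
begin

text \<open>Representatives \<open>R\<close> of the cosets in \<open>C\<close>, together with a
  basis \<open>B\<close> of \<open>U\<close>, form a basis of \<open>W\<close>.\<close>

lemma quotient_basis_card:
  assumes U: "subspace U" and W: "subspace W" "U \<subseteq> W" and C: "quotient_basis scale W U C"
  shows "card C + dim U = dim W"
proof -
  obtain R where R: "R \<subseteq> W" "inj_on (\<lambda>b. b +o U) R" "C = (\<lambda>b. b +o U) ` R"
    using C unfolding quotient_basis_def quotient_space_def subset_image_inj by auto
  have "finite R" using C R(2,3) by (auto simp: quotient_basis_def dest: finite_imageD)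
  have lc: "quotient_lincomb scale U f C = (\<Sum>b\<in>R. f (b +o U) *s b) +o U" for f
    unfolding R(3) by (rule quotient_lincomb_cosets[OF U \<open>finite R\<close> R(2)])
  have indep: "\<forall>b\<in>R. c b = 0" if "(\<Sum>b\<in>R. c b *s b) \<in> U" for c
  proof -
    \<comment> \<open>Independence of \<open>C\<close> speaks of coefficients indexed by cosets. As
      representatives are unique, coefficients on \<open>R\<close> can be carried over to
      cosets.\<close>
    define f where "f A = c (inv_into R (\<lambda>b. b +o U) A)" for A
    have f: "f (b +o U) = c b" if "b \<in> R" for b
      unfolding f_def using inv_into_f_f[OF R(2) that] by simp
    have "(\<Sum>b\<in>R. f (b +o U) *s b) +o U = U"
      using that coset_eq_iff[OF U, of "\<Sum>b\<in>R. c b *s b" 0] by (simp add: f)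
    then have "\<forall>A\<in>C. f A = 0" using C lc by (auto simp: quotient_basis_def)
    then show ?thesis using f R(3) by auto
  qed
  obtain B where B: "finite B" "B \<subseteq> U" "independent B" "span B = U" "card B = dim U"
    using basis_subspace_exists[OF U] by blast
  have disj: "R \<inter> B = {}"
  proof (rule ccontr)
    assume "R \<inter> B \<noteq> {}"
    then obtain b where b: "b \<in> R" "b \<in> U" using B by auto
    \<comment> \<open>A representative lying in \<open>U\<close> would itself be a combination of
      \<open>R\<close> in \<open>U\<close> with a coefficient 1.\<close>
    have "(\<Sum>x\<in>R. (if x = b then 1 else 0) *s x) = (\<Sum>x\<in>R. if x = b then x else 0)"
      by (rule sum.cong) auto
    also have "\<dots> = b" using b \<open>finite R\<close> by simp
    finally show False using indep[of "\<lambda>x. if x = b then 1 else 0"] b by auto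
  qed
  have "independent (R \<union> B)"
    unfolding independent_explicit
  proof (intro conjI allI impI)
    show "finite (R \<union> B)" using \<open>finite R\<close> B by simp
    fix c assume "(\<Sum>v\<in>R \<union> B. c v *s v) = 0"
    then have eq: "(\<Sum>v\<in>R. c v *s v) + (\<Sum>v\<in>B. c v *s v) = 0"
      using sum.union_disjoint[OF \<open>finite R\<close> B(1) disj, of "\<lambda>v. c v *s v"] by simp
    have "(\<Sum>v\<in>B. c v *s v) \<in> U" using B(2) by (intro subspace_sum[OF U] subspace_scale[OF U]) auto
    then have "- (\<Sum>v\<in>B. c v *s v) \<in> U" by (rule subspace_neg[OF U])
    \<comment> \<open>In a relation on \<open>R \<union> B\<close> the \<open>R\<close>-part is the
      negative of a vector of \<open>U\<close>. So its coefficients vanish modulo \<open>U\<close>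
      first, and those on \<open>B\<close> vanish afterwards.\<close>
    then have "(\<Sum>v\<in>R. c v *s v) \<in> U"
      using eq by (simp only: eq_neg_iff_add_eq_0[symmetric])
    then have cR: "\<forall>b\<in>R. c b = 0" by (rule indep)
    then have "(\<Sum>v\<in>B. c v *s v) = 0" using eq by simp
    then have "\<forall>b\<in>B. c b = 0" using independentD[OF B(3,1) subset_refl] by simp
    then show "\<forall>v\<in>R \<union> B. c v = 0" using cR by blast
  qed
  moreover have "W \<subseteq> span (R \<union> B)"
  proof
    fix w assume "w \<in> W"
    then have "w +o U \<in> quotient_space W U" by (simp add: quotient_space_def)
    then obtain f where "w +o U = quotient_lincomb scale U f C"
      using C by (auto simp: quotient_basis_def)
    then have "w - (\<Sum>b\<in>R. f (b +o U) *s b) \<in> U" by (simp add: lc coset_eq_iff[OF U])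
    then have "w - (\<Sum>b\<in>R. f (b +o U) *s b) \<in> span (R \<union> B)"
      using B(4) span_mono[of B "R \<union> B"] by auto
    moreover have "(\<Sum>b\<in>R. f (b +o U) *s b) \<in> span (R \<union> B)"
      by (intro span_sum span_scale span_base) auto
    ultimately have "(w - (\<Sum>b\<in>R. f (b +o U) *s b)) + (\<Sum>b\<in>R. f (b +o U) *s b) \<in> span (R \<union> B)"
      by (rule span_add)
    then show "w \<in> span (R \<union> B)" by simp
  qed
  ultimately have "dim W = card (R \<union> B)" using R(1) B(2) W by (intro dim_unique[of "R \<union> B"]) auto
  also have "\<dots> = card R + card B" using \<open>finite R\<close> B(1) disj by (rule card_Un_disjoint)
  finally show ?thesis using card_image[OF R(2)] R(3) B(5) by simp
qed

text \<open>A basis \<open>B\<close> of \<open>U\<close> extends to a basis \<open>E\<close> of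
  \<open>W\<close>, and the cosets of the added vectors \<open>E - B\<close> form a basis of the
  quotient.\<close>

lemma quotient_basis_exists:
  assumes U: "subspace U" and W: "subspace W" "U \<subseteq> W"
  shows "\<exists>C. quotient_basis scale W U C"
proof -
  obtain B where B: "finite B" "B \<subseteq> U" "independent B" "span B = U" "card B = dim U"
    using basis_subspace_exists[OF U] by blast
  obtain E where E: "B \<subseteq> E" "E \<subseteq> W" "independent E" "W \<subseteq> span E"
    using maximal_independent_subset_extend[of B W] B W by blast
  have "finite E" using E(3) by (rule finiteI_independent)
  define R where "R = E - B"
  have R: "finite R" "R \<inter> B = {}" "R \<union> B = E" using \<open>finite E\<close> E(1) by (auto simp: R_def)
  have indep: "\<forall>b\<in>R. c b = 0" if mem: "(\<Sum>b\<in>R. c b *s b) \<in> U" for c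
  proof -
    obtain d where d: "(\<Sum>b\<in>R. c b *s b) = (\<Sum>b\<in>B. d b *s b)"
      using mem span_finite[OF B(1)] B(4) by auto
    \<comment> \<open>Moving the expansion over \<open>B\<close> to the other side turns membership
      in \<open>U\<close> into a linear relation on \<open>E\<close>.\<close>
    define e where "e v = (if v \<in> R then c v else - d v)" for v
    have "(\<Sum>v\<in>R. e v *s v) = (\<Sum>v\<in>R. c v *s v)" by (rule sum.cong) (auto simp: e_def)
    moreover have "(\<Sum>v\<in>B. e v *s v) = (\<Sum>v\<in>B. - (d v *s v))"
      using R(2) by (intro sum.cong) (auto simp: e_def)
    ultimately have "(\<Sum>v\<in>R \<union> B. e v *s v) = 0"
      using sum.union_disjoint[OF R(1) B(1) R(2), of "\<lambda>v. e v *s v"] d by (simp add: sum_negf)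
    then have "\<forall>v\<in>E. e v = 0"
      unfolding R(3) using independentD[OF E(3) \<open>finite E\<close> subset_refl, of e] by simp
    then show ?thesis using R(3) unfolding e_def by (metis UnI1)
  qed
  have inj: "inj_on (\<lambda>b. b +o U) R"
  proof (rule inj_onI, rule ccontr)
    fix x y assume xy: "x \<in> R" "y \<in> R" "x +o U = y +o U" "x \<noteq> y"
    \<comment> \<open>Two vectors with the same coset have their difference in \<open>U\<close>,
      which is a combination of \<open>R\<close> with nonzero coefficients.\<close>
    define c where "c v = (if v = x then 1 else if v = y then -1 else 0 :: 'a)" for v
    have "(\<Sum>v\<in>R. c v *s v) = (\<Sum>v\<in>{x, y}. c v *s v)"
      using xy R(1) by (intro sum.mono_neutral_right) (auto simp: c_def)
    also have "\<dots> = x - y" using xy by (simp add: c_def)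
    finally have "\<forall>b\<in>R. c b = 0" using indep xy coset_eq_iff[OF U] by simp
    then show False using xy by (auto simp: c_def)
  qed
  have lc: "quotient_lincomb scale U f ((\<lambda>b. b +o U) ` R) = (\<Sum>b\<in>R. f (b +o U) *s b) +o U" for f
    by (rule quotient_lincomb_cosets[OF U R(1) inj])
  have "quotient_basis scale W U ((\<lambda>b. b +o U) ` R)"
    unfolding quotient_basis_def
  proof (intro conjI allI impI ballI)
    show "finite ((\<lambda>b. b +o U) ` R)" using R by simp
    show "(\<lambda>b. b +o U) ` R \<subseteq> quotient_space W U"
      using E R by (auto simp: quotient_space_def)
  next
    fix f A assume "quotient_lincomb scale U f ((\<lambda>b. b +o U) ` R) = U" and A: "A \<in> (\<lambda>b. b +o U) ` R"
    then have "(\<Sum>b\<in>R. f (b +o U) *s b) \<in> U"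
      using coset_eq_iff[OF U, of _ 0] by (simp add: lc)
    from indep[OF this] show "f A = 0" using A by auto
  next
    fix A assume "A \<in> quotient_space W U"
    then obtain w where w: "w \<in> W" "A = w +o U" by (auto simp: quotient_space_def)
    then obtain c where "w = (\<Sum>v\<in>E. c v *s v)" using E(4) span_finite[OF \<open>finite E\<close>] by auto
    then have "w = (\<Sum>v\<in>R. c v *s v) + (\<Sum>v\<in>B. c v *s v)"
      using sum.union_disjoint[OF R(1) B(1) R(2), of "\<lambda>v. c v *s v"] R(3) by simp
    moreover have "(\<Sum>v\<in>B. c v *s v) \<in> U"
      using B(2) by (intro subspace_sum[OF U] subspace_scale[OF U]) auto
    ultimately have "A = (\<Sum>v\<in>R. c v *s v) +o U" unfolding w(2) by (simp add: coset_eq_iff[OF U])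
    moreover have "(\<Sum>v\<in>R. c (inv_into R (\<lambda>b. b +o U) (v +o U)) *s v) = (\<Sum>v\<in>R. c v *s v)"
      using inv_into_f_f[OF inj] by (intro sum.cong) auto
    ultimately show "\<exists>f. A = quotient_lincomb scale U f ((\<lambda>b. b +o U) ` R)"
      by (intro exI[of _ "\<lambda>A. c (inv_into R (\<lambda>b. b +o U) A)"]) (simp add: lc)
  qed
  then show ?thesis ..
qed

text \<open>Every basis of the quotient has the right cardinality, hence so does the one picked by
  \<open>SOME\<close>. The additive form avoids truncated subtraction.\<close>

lemma quotient_dim_add_dim:
  assumes "subspace U" "subspace W" "U \<subseteq> W"
  shows "quotient_dim scale W U + dim U = dim W"
  unfolding quotient_dim_def
  using quotient_basis_card[OF assms] someI_ex[OF quotient_basis_exists[OF assms]] by blast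

end

section \<open>Generation in semigroups\<close>

lemma sg_generated_incl: "g \<in> G \<Longrightarrow> g \<in> sg_generated m G"
  unfolding sg_generated_def by (intro CollectI exI[of _ g] exI[of _ "[]"]) simp

lemma sg_generated_minimal:
  assumes "G \<subseteq> S" "\<And>a b. a \<in> S \<Longrightarrow> b \<in> S \<Longrightarrow> m a b \<in> S"
  shows "sg_generated m G \<subseteq> S"
proof -
  have "foldl m g gs \<in> S" if "g \<in> S" "set gs \<subseteq> S" for g gs
    using that by (induction gs arbitrary: g) (auto simp: assms(2))
  then show ?thesis using assms(1) unfolding sg_generated_def by blast
qed

lemma sg_generated_closed:
  assumes assoc: "\<And>a b c. m (m a b) c = m a (m b c)"
    and "a \<in> sg_generated m G" "b \<in> sg_generated m G"
  shows "m a b \<in> sg_generated m G"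
proof -
  obtain g gs h hs where *: "a = foldl m g gs" "g \<in> G" "set gs \<subseteq> G"
    "b = foldl m h hs" "h \<in> G" "set hs \<subseteq> G"
    using assms(2,3) unfolding sg_generated_def by blast
  \<comment> \<open>By associativity a left factor moves into the start of the fold, so two products
    concatenate into one.\<close>
  have "m x (foldl m h hs) = foldl m (m x h) hs" for x
    by (induction hs rule: rev_induct) (simp_all add: assoc[symmetric])
  then have "m a b = foldl m g (gs @ h # hs)" using * by simp
  then show ?thesis using * unfolding sg_generated_def
    by (intro CollectI exI[of _ g] exI[of _ "gs @ h # hs"]) simp
qed

lemma sg_rank_le_card: "G \<subseteq> S \<Longrightarrow> finite G \<Longrightarrow> S = sg_generated m G \<Longrightarrow> sg_rank m S \<le> card G"
  unfolding sg_rank_def by (rule Least_le) auto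

text \<open>A finite closed \<open>S\<close> generates itself, so \<open>LEAST\<close> ranges over a
  nonempty set and its value comes from an actual generating set.\<close>

lemma sg_rank_attained:
  assumes "finite S" "\<And>a b. a \<in> S \<Longrightarrow> b \<in> S \<Longrightarrow> m a b \<in> S"
  obtains G where "G \<subseteq> S" "finite G" "card G = sg_rank m S" "S = sg_generated m G"
proof -
  have "sg_generated m S \<subseteq> S" by (rule sg_generated_minimal) (auto intro: assms(2))
  then have "S = sg_generated m S" by (auto intro: sg_generated_incl)
  then have "\<exists>k. \<exists>G\<subseteq>S. finite G \<and> card G = k \<and> S = sg_generated m G"
    using assms(1) by (intro exI[of _ "card S"] exI[of _ S]) simp
  from LeastI_ex[OF this] obtain G where
    "G \<subseteq> S" "finite G" "card G = sg_rank m S" "S = sg_generated m G"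
    unfolding sg_rank_def by (elim exE conjE)
  then show ?thesis by (rule that)
qed

lemma map_mult_assoc: "map_mult (map_mult a b) c = map_mult a (map_mult b c)"
  by (simp add: map_mult_def comp_assoc)

lemma L_GL_mult: "a \<in> L_GL scale U \<Longrightarrow> b \<in> L_GL scale U \<Longrightarrow> map_mult a b \<in> L_GL scale U"
  by (auto simp: L_GL_def map_mult_def Vector_Spaces.linear_compose bij_betw_trans)

section \<open>Factorisation of singular maps\<close>

text \<open>Each added spanning vector \<open>a\<close> enlarges the span to an image of pairs of a
  scalar and an old vector, so spans of finite sets stay finite.\<close>

lemma (in finite_dimensional_vector_space) finite_UNIV_if_finite_field:
  assumes "finite (UNIV :: 'a set)"
  shows "finite (UNIV :: 'b set)"
proof -
  have "finite (span S)" if "finite S" for S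
    using that
  proof induction
    case (insert a S)
    have "span (insert a S) \<subseteq> (\<lambda>(c, y). y + c *s a) ` (UNIV \<times> span S)"
      by (force simp: span_breakdown_eq)
    then show ?case using insert assms by (meson finite_SigmaI finite_imageI finite_subset)
  qed simp
  from this[OF finite_Basis] show ?thesis by (simp add: span_Basis)
qed

section \<open>Linear functionals vanishing on a subspace\<close>

context vector_space
begin

lemma subspace_range_linear: "Vector_Spaces.linear scale scale f \<Longrightarrow> subspace (range f)"
  by (rule module_hom.subspace_image[OF _ subspace_UNIV]) (simp add: module_hom_iff_linear)

lemma linear_add_functional:
  assumes "Vector_Spaces.linear scale scale f" "Vector_Spaces.linear scale (*) \<phi>"
  shows "Vector_Spaces.linear scale scale (\<lambda>v. f v + \<phi> v *s c)"
  using assms by (auto simp: Vector_Spaces.linear_iff algebra_simps)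

lemma functional_simps:
  assumes "Vector_Spaces.linear scale (*) \<phi>"
  shows "\<phi> (x + y) = \<phi> x + \<phi> y" "\<phi> (c *s x) = c * \<phi> x"
    "\<phi> (- x) = - \<phi> x" "\<phi> (x - y) = \<phi> x - \<phi> y"
proof -
  have add: "\<phi> (x + y) = \<phi> x + \<phi> y" and scale: "\<phi> (c *s x) = c * \<phi> x" for x y c
    using assms by (simp_all add: Vector_Spaces.linear_iff)
  have neg: "\<phi> (- x) = - \<phi> x" for x using scale[of "- 1" x] by simp
  show "\<phi> (x + y) = \<phi> x + \<phi> y" "\<phi> (c *s x) = c * \<phi> x" "\<phi> (- x) = - \<phi> x"
    by (fact add scale neg)+
  show "\<phi> (x - y) = \<phi> x - \<phi> y" using add[of x "- y"] neg by simp
qed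

text \<open>With the field as a vector space over itself, a functional is a linear map, and such
  maps can be prescribed on independent sets.\<close>

lemma functional_extend:
  fixes f :: "'b \<Rightarrow> 'a"
  assumes "independent B"
  obtains \<phi> where "Vector_Spaces.linear scale (*) \<phi>" "\<forall>b\<in>B. \<phi> b = f b"
proof -
  interpret field: vector_space "(*) :: 'a \<Rightarrow> 'a \<Rightarrow> 'a"
    by unfold_locales (auto simp: algebra_simps)
  interpret vector_space_pair scale "(*) :: 'a \<Rightarrow> 'a \<Rightarrow> 'a" ..
  show ?thesis
    by (rule that[OF linear_construct[OF assms, of f]]) (simp add: construct_basis[OF assms])
qed

text \<open>The functional is 0 on a basis of \<open>U\<close> and 1 on the vectors added to it. If
  \<open>a\<close> depends on \<open>U\<close> and \<open>k\<close>, then \<open>a\<close> is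
  congruent to a nonzero multiple of \<open>k\<close> modulo \<open>U\<close>, so its value is
  nonzero all the same.\<close>

lemma functional_separating_two:
  assumes U: "subspace U" and k: "k \<notin> U" and a: "a \<notin> U"
  obtains \<phi> where "Vector_Spaces.linear scale (*) \<phi>" "\<And>u. u \<in> U \<Longrightarrow> \<phi> u = 0" "\<phi> k = 1" "\<phi> a \<noteq> 0"
proof -
  obtain B where B: "B \<subseteq> U" "independent B" "U \<subseteq> span B" by (rule basis_exists)
  have "span B = U" using B U by (simp add: span_subspace)
  define f where "f b = (if b \<in> B then 0 else 1 :: 'a)" for b
  define K where "K = insert k B"
  have K: "independent K" unfolding K_def
    using k B \<open>span B = U\<close> by (intro independent_insertI) auto
  define E where "E = (if a \<in> span K then K else insert a K)"
  have "independent E" using K by (auto simp: E_def independent_insertI)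
  have E: "k \<in> E" "\<And>b. b \<in> B \<Longrightarrow> b \<in> E" by (simp_all add: E_def K_def)
  obtain \<phi> where \<phi>: "Vector_Spaces.linear scale (*) \<phi>" "\<forall>b\<in>E. \<phi> b = f b"
    by (rule functional_extend[OF \<open>independent E\<close>, of f])
  note \<phi>_simps = functional_simps[OF \<phi>(1)]
  have vanish: "\<phi> u = 0" if "u \<in> U" for u
  proof (rule module_hom.eq_0_on_span[OF \<phi>(1)[folded module_hom_iff_linear]])
    show "u \<in> span B" using that B(3) by blast
    fix b assume "b \<in> B"
    then show "\<phi> b = 0" using bspec[OF \<phi>(2) E(2)[of b]] by (simp add: f_def)
  qed
  have "\<phi> k = 1" using bspec[OF \<phi>(2) E(1)] k B(1) by (auto simp: f_def)
  have "\<phi> a \<noteq> 0"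
  proof (cases "a \<in> span K")
    case True
    then obtain c where c: "a - c *s k \<in> U"
      by (auto simp: K_def span_breakdown_eq \<open>span B = U\<close>)
    then have "c \<noteq> 0" using a by auto
    moreover have "\<phi> (a - c *s k) = 0" using c by (rule vanish)
    ultimately show ?thesis using \<open>\<phi> k = 1\<close> by (simp add: \<phi>_simps)
  next
    case False
    then have "a \<in> E" by (simp add: E_def)
    from bspec[OF \<phi>(2) this] show ?thesis using a B(1) by (auto simp: f_def)
  qed
  show ?thesis by (rule that[OF \<phi>(1) vanish \<open>\<phi> k = 1\<close> \<open>\<phi> a \<noteq> 0\<close>])
qed

end

section \<open>Inverses, kernels and the factorisation step\<close>

context finite_dimensional_vector_space
begin

lemma L_GL_inv:
  assumes "\<alpha> \<in> L_GL scale U" "inj \<alpha>"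
  shows "inv \<alpha> \<in> L_GL scale U"
proof -
  have "\<alpha> ` U = U" using assms(1) by (auto simp: L_GL_def bij_betw_def)
  then have "bij_betw (inv \<alpha>) U U"
    using assms(2) by (intro bij_betw_inv_into_subset[of \<alpha> UNIV "range \<alpha>"])
      (auto simp: bij_betw_def)
  then show ?thesis
    using assms inj_linear_imp_inv_linear by (simp add: L_GL_def)
qed

text \<open>A nonzero kernel vector cannot lie in \<open>U\<close>, where \<open>\<alpha>\<close> is
  injective.\<close>

lemma L_GL_kernel:
  assumes "\<alpha> \<in> L_GL scale U" "subspace U" "\<not> inj \<alpha>"
  obtains k where "\<alpha> k = 0" "k \<notin> U"
proof -
  interpret Vector_Spaces.linear scale scale \<alpha> using assms by (simp add: L_GL_def)
  obtain k where k: "\<alpha> k = 0" "k \<noteq> 0" using assms(3) inj_iff_eq_0 by auto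
  have "0 \<in> U" "inj_on \<alpha> U" using assms by (auto simp: subspace_0 L_GL_def bij_betw_def)
  then have "k \<notin> U" using k inj_onD[of \<alpha> U k 0] by (auto simp: zero)
  then show ?thesis using that k by blast
qed

text \<open>The witness is \<open>\<beta> + \<phi> c\<close>, which takes the kernel vector \<open>k\<close> of \<open>\<beta>\<close> to \<open>\<phi>(k) c\<close>.\<close>
lemma L_GL_extend_range:
  assumes \<beta>: "\<beta> \<in> L_GL scale U" "\<beta> k = 0"
    and \<phi>: "Vector_Spaces.linear scale (*) \<phi>" "\<And>u. u \<in> U \<Longrightarrow> \<phi> u = 0" "\<phi> k \<noteq> 0"
  obtains \<gamma> where "\<gamma> \<in> L_GL scale U" "\<beta> = \<gamma> \<circ> (\<lambda>v. v - (\<phi> v / \<phi> k) *s k)"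
    "c \<in> range \<gamma>" "range \<beta> \<subseteq> range \<gamma>"
proof -
  define \<gamma> where "\<gamma> v = \<beta> v + \<phi> v *s c" for v
  interpret \<beta>: Vector_Spaces.linear scale scale \<beta> using assms by (simp add: L_GL_def)
  note \<phi>_simps = functional_simps[OF \<phi>(1)]
  have "Vector_Spaces.linear scale scale \<gamma>"
    unfolding \<gamma>_def by (rule linear_add_functional) (rule \<beta>.linear_axioms \<phi>(1))+
  moreover have "bij_betw \<gamma> U U \<longleftrightarrow> bij_betw \<beta> U U"
    by (rule bij_betw_cong) (simp add: \<gamma>_def \<phi>)
  ultimately have "\<gamma> \<in> L_GL scale U" using \<beta> by (simp add: L_GL_def)
  moreover have eq: "\<beta> = \<gamma> \<circ> (\<lambda>v. v - (\<phi> v / \<phi> k) *s k)"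
    using \<beta>(2) \<phi>(3) by (simp add: fun_eq_iff \<gamma>_def \<beta>.diff \<beta>.scale \<phi>_simps)
  moreover have "range \<beta> \<subseteq> range \<gamma>" by (subst eq) auto
  moreover have "\<gamma> ((1 / \<phi> k) *s k) = c"
    using \<beta>(2) \<phi>(3) by (simp add: \<gamma>_def \<beta>.scale \<phi>_simps)
  then have "c \<in> range \<gamma>" by (metis rangeI)
  ultimately show ?thesis using that by blast
qed

text \<open>The unit \<open>h\<close> is the inverse of the map \<delta> obtained by extending
  \<open>\<alpha>\<close> at \<open>a\<close>, and \<open>g\<close> carries the projection along
  \<open>k\<close> to the one along \<open>a\<close>.\<close>

lemma L_GL_factor:
  assumes U: "subspace U"
    and \<alpha>: "\<alpha> \<in> L_GL scale U" "\<not> inj \<alpha>" "dim (range \<alpha>) + 1 = dim UNIV"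
    and \<beta>: "\<beta> \<in> L_GL scale U" "\<not> inj \<beta>"
  obtains \<gamma> g h where "\<gamma> \<in> L_GL scale U" "range \<beta> \<subset> range \<gamma>"
    "g \<in> L_GL scale U" "inj g" "h \<in> L_GL scale U" "inj h" "\<beta> = \<gamma> \<circ> h \<circ> \<alpha> \<circ> g"
proof -
  obtain k where k: "\<beta> k = 0" "k \<notin> U" by (rule L_GL_kernel[OF \<beta>(1) U \<beta>(2)])
  obtain a where a: "\<alpha> a = 0" "a \<notin> U" by (rule L_GL_kernel[OF \<alpha>(1) U \<alpha>(2)])
  obtain \<phi> where \<phi>: "Vector_Spaces.linear scale (*) \<phi>" "\<And>u. u \<in> U \<Longrightarrow> \<phi> u = 0" "\<phi> k = 1" "\<phi> a \<noteq> 0"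
    using functional_separating_two[OF U k(2) a(2)] by blast
  note \<phi>_simps = functional_simps[OF \<phi>(1)]
  have "\<phi> k \<noteq> 0" using \<phi>(3) by simp
  have lin: "Vector_Spaces.linear scale scale \<alpha>" "Vector_Spaces.linear scale scale \<beta>" using \<alpha> \<beta> by (auto simp: L_GL_def)
  have "\<not> surj \<alpha>" "\<not> surj \<beta>" using lin \<alpha>(2) \<beta>(2) linear_surj_imp_inj by auto
  then obtain c d where c: "c \<notin> range \<alpha>" and d: "d \<notin> range \<beta>" by blast
  obtain \<gamma> where \<gamma>: "\<gamma> \<in> L_GL scale U" "\<beta> = \<gamma> \<circ> (\<lambda>v. v - (\<phi> v / \<phi> k) *s k)"
    "d \<in> range \<gamma>" "range \<beta> \<subseteq> range \<gamma>"
    using L_GL_extend_range[OF \<beta>(1) k(1) \<phi>(1,2) \<open>\<phi> k \<noteq> 0\<close>, of d] by blast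
  obtain \<delta> where \<delta>: "\<delta> \<in> L_GL scale U" "\<alpha> = \<delta> \<circ> (\<lambda>v. v - (\<phi> v / \<phi> a) *s a)"
    "c \<in> range \<delta>" "range \<alpha> \<subseteq> range \<delta>"
    using L_GL_extend_range[OF \<alpha>(1) a(1) \<phi>(1,2,4), of c] by blast
  have "Vector_Spaces.linear scale scale \<delta>" using \<delta>(1) by (simp add: L_GL_def)
  have sub: "subspace (range \<alpha>)" "subspace (range \<delta>)"
    using lin(1) \<open>Vector_Spaces.linear scale scale \<delta>\<close>
    by (simp_all add: subspace_range_linear)
  \<comment> \<open>The range of \<open>\<alpha>\<close> is a hyperplane, so any strictly larger
    range is the whole space and \<open>\<delta>\<close> is a unit.\<close>
  have "range \<alpha> \<subset> range \<delta>" using c \<delta>(3,4) by blast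
  then have "dim (range \<alpha>) < dim (range \<delta>)"
    using sub by (intro dim_psubset) (simp only: span_eq_iff[THEN iffD2])
  then have "range \<delta> = UNIV"
    using \<alpha>(3) sub(2) by (intro subspace_dim_equal) auto
  then have "inj \<delta>" using linear_surj_imp_inj[OF \<open>Vector_Spaces.linear scale scale \<delta>\<close>] by simp
  \<comment> \<open>This map fixes \<open>U\<close> pointwise, sends \<open>k\<close> to
    \<open>a\<close> and multiplies the values of \<open>\<phi>\<close> by \<open>\<phi> a\<close>,
    which is nonzero; the last fact gives injectivity.\<close>
  define g where "g v = v + \<phi> v *s (a - k)" for v
  have g_lin: "Vector_Spaces.linear scale scale g"
    unfolding g_def by (rule linear_add_functional[OF linear_ident \<phi>(1)])
  interpret g: Vector_Spaces.linear scale scale g by fact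
  have "inj g"
    unfolding g.inj_iff_eq_0
  proof (intro allI impI)
    fix v assume v: "g v = 0"
    have "\<phi> (g v) = \<phi> v * \<phi> a"
      by (simp add: g_def \<phi>_simps \<phi>(3) algebra_simps)
    then have "\<phi> v = 0" using v \<phi>(4) \<phi>_simps(2)[of 0 v] by simp
    then show "v = 0" using v by (simp add: g_def)
  qed
  have "bij_betw g U U \<longleftrightarrow> bij_betw id U U"
    by (rule bij_betw_cong) (simp add: g_def \<phi>)
  then have "g \<in> L_GL scale U" using g_lin by (simp add: L_GL_def)
  \<comment> \<open>Since \<open>\<phi> (g v) / \<phi> a = \<phi> v\<close>, subtracting that
    multiple of \<open>a\<close> from \<open>g v\<close> leaves \<open>v - \<phi> v k\<close>, the
    projection along \<open>k\<close>.\<close>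
  have "g v - (\<phi> (g v) / \<phi> a) *s a = v - (\<phi> v / \<phi> k) *s k" for v
    using \<phi>(4)
    by (simp add: g_def \<phi>_simps \<phi>(3) algebra_simps add_divide_distrib diff_divide_distrib)
  then have "\<alpha> \<circ> g = \<delta> \<circ> (\<lambda>v. v - (\<phi> v / \<phi> k) *s k)"
    by (subst \<delta>(2)) (simp add: fun_eq_iff)
  then have "inv \<delta> \<circ> (\<alpha> \<circ> g) = (\<lambda>v. v - (\<phi> v / \<phi> k) *s k)"
    using \<open>inj \<delta>\<close> by (simp add: fun_eq_iff)
  then have "\<beta> = \<gamma> \<circ> inv \<delta> \<circ> \<alpha> \<circ> g" using \<gamma>(2) by (simp add: comp_assoc)
  moreover have "inv \<delta> \<in> L_GL scale U" by (rule L_GL_inv[OF \<delta>(1) \<open>inj \<delta>\<close>])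
  moreover have "range \<beta> \<subset> range \<gamma>" using d \<gamma>(3,4) by blast
  moreover have "inj (inv \<delta>)" using \<open>range \<delta> = UNIV\<close> by (simp add: surj_imp_inj_inv)
  ultimately show ?thesis
    by (intro that[of \<gamma> g "inv \<delta>"] \<gamma>(1) \<open>g \<in> L_GL scale U\<close> \<open>inj g\<close>)
qed

lemma L_GL_eq_sg_generated:
  assumes fin: "finite (UNIV :: 'b set)" and U: "subspace U"
    and \<alpha>: "\<alpha> \<in> L_GL scale U" "\<not> inj \<alpha>" "dim (range \<alpha>) + 1 = dim UNIV"
  shows "L_GL scale U = sg_generated map_mult ({g \<in> L_GL scale U. inj g} \<union> {\<alpha>})"
proof
  let ?G = "{g \<in> L_GL scale U. inj g} \<union> {\<alpha>}"
  show "sg_generated map_mult ?G \<subseteq> L_GL scale U"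
    using \<alpha> by (intro sg_generated_minimal L_GL_mult) auto
  have "\<beta> \<in> sg_generated map_mult ?G" if "\<beta> \<in> L_GL scale U" for \<beta>
    using that
  \<comment> \<open>Finiteness of the space makes the number of vectors missed by the range a
    measure, and it drops from \<open>\<beta>\<close> to \<open>\<gamma>\<close>.\<close>
  proof (induction "card (UNIV :: 'b set) - card (range \<beta>)" arbitrary: \<beta> rule: less_induct)
    case less
    show ?case
    proof (cases "inj \<beta>")
      case True
      then show ?thesis using less.prems by (intro sg_generated_incl) auto
    next
      case False
      obtain \<gamma> g h where *: "\<gamma> \<in> L_GL scale U" "range \<beta> \<subset> range \<gamma>"
        "g \<in> L_GL scale U" "inj g" "h \<in> L_GL scale U" "inj h" "\<beta> = \<gamma> \<circ> h \<circ> \<alpha> \<circ> g"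
        by (rule L_GL_factor[OF U \<alpha> less.prems False])
      have "card (range \<beta>) < card (range \<gamma>)" "card (range \<gamma>) \<le> card (UNIV :: 'b set)"
        using fin *(2) by (auto intro: psubset_card_mono card_mono finite_subset)
      then have "\<gamma> \<in> sg_generated map_mult ?G" using *(1) by (intro less.hyps) auto
      then have "map_mult (map_mult (map_mult g \<alpha>) h) \<gamma> \<in> sg_generated map_mult ?G"
        using * by (intro sg_generated_closed[of map_mult, OF map_mult_assoc])
          (auto intro: sg_generated_incl)
      \<comment> \<open>\<open>map_mult\<close> applies its left argument first, so the factors
        appear in the reverse order of the composition.\<close>
      moreover have "\<beta> = map_mult (map_mult (map_mult g \<alpha>) h) \<gamma>"
        using *(7) by (simp add: map_mult_def comp_assoc)
      ultimately show ?thesis by simp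
    qed
  qed
  then show "L_GL scale U \<subseteq> sg_generated map_mult ?G" by blast
qed

section \<open>The sets J(k) described by the dimension of the range\<close>

lemma J_iff_dim:
  assumes U: "subspace U"
  shows "\<alpha> \<in> J scale U k \<longleftrightarrow> \<alpha> \<in> L_GL scale U \<and> k + dim U = dim (range \<alpha>)"
proof -
  have "quotient_dim scale (range \<alpha>) U + dim U = dim (range \<alpha>)" if "\<alpha> \<in> L_GL scale U"
  proof (rule quotient_dim_add_dim[OF U])
    show "subspace (range \<alpha>)"
      using that by (simp add: L_GL_def subspace_range_linear)
    show "U \<subseteq> range \<alpha>" using that by (auto simp: L_GL_def bij_betw_def)
  qed
  then show ?thesis by (auto simp: J_def)
qed

text \<open>Quotient dimension \<open>n - r\<close> means full range, and on a finite-dimensional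
  space this is the same as injectivity. So this set is the group of units.\<close>

lemma J_top:
  assumes U: "subspace U"
  shows "J scale U (dim UNIV - dim U) = {\<alpha> \<in> L_GL scale U. inj \<alpha>}"
proof -
  have "dim U \<le> dim UNIV" by (rule dim_subset) simp
  moreover have "dim (range \<alpha>) = dim UNIV \<longleftrightarrow> inj \<alpha>" if "Vector_Spaces.linear scale scale \<alpha>" for \<alpha>
  proof
    have "subspace (range \<alpha>)"
      using that by (rule subspace_range_linear)
    moreover assume "dim (range \<alpha>) = dim UNIV"
    ultimately have "range \<alpha> = UNIV" by (intro subspace_dim_equal) auto
    then show "inj \<alpha>" using linear_surj_imp_inj[OF that] by simp
  next
    assume "inj \<alpha>"
    then show "dim (range \<alpha>) = dim UNIV" using linear_inj_imp_surj[OF that] by simp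
  qed
  ultimately show ?thesis
    by (auto simp: J_iff_dim[OF U] L_GL_def eq_commute[of _ "dim (range _)"])
qed

lemma dim_less_dim_UNIV:
  assumes "subspace U" "U \<noteq> UNIV"
  shows "dim U < dim UNIV"
proof -
  have "span U \<subset> span UNIV" using assms by (simp only: span_eq_iff[THEN iffD2] subspace_UNIV) blast
  then show ?thesis by (rule dim_psubset)
qed

text \<open>The rank bound needs some \<open>\<alpha>\<close> to exist. The projection along a
  vector \<open>k\<close> outside \<open>U\<close>, with a functional vanishing on \<open>U\<close>,
  provides it.\<close>

lemma J_corank_one_nonempty:
  assumes U: "subspace U" "U \<noteq> UNIV"
  shows "J scale U (dim UNIV - dim U - 1) \<noteq> {}"
proof -
  obtain k where k: "k \<notin> U" using U by blast
  obtain \<phi> where \<phi>: "Vector_Spaces.linear scale (*) \<phi>" "\<And>u. u \<in> U \<Longrightarrow> \<phi> u = 0" "\<phi> k = 1"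
    using functional_separating_two[OF U(1) k k] by blast
  define e where "e v = v + \<phi> v *s (- k)" for v
  note \<phi>_simps = functional_simps[OF \<phi>(1)]
  have e: "Vector_Spaces.linear scale scale e"
    unfolding e_def by (rule linear_add_functional[OF linear_ident \<phi>(1)])
  have sub: "subspace (range e)"
    using e by (rule subspace_range_linear)
  have "bij_betw e U U \<longleftrightarrow> bij_betw id U U"
    by (rule bij_betw_cong) (simp add: e_def \<phi>)
  then have "e \<in> L_GL scale U" using e by (simp add: L_GL_def)
  \<comment> \<open>The range lies in the kernel of \<open>\<phi>\<close>, hence misses
    \<open>k\<close>; adding \<open>k\<close> to it spans everything, so the range is a
    hyperplane.\<close>
  have "\<phi> (e v) = 0" for v by (simp add: e_def \<phi>_simps \<phi>(3))
  then have "k \<notin> span (range e)" using \<phi>(3) sub by (metis rangeE span_eq_iff zero_neq_one)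
  moreover have "span (insert k (range e)) = UNIV"
  proof -
    have "v \<in> span (insert k (range e))" for v
    proof -
      have "v - \<phi> v *s k \<in> span (range e)" by (rule span_base) (auto simp: e_def image_iff)
      then show ?thesis by (auto simp: span_breakdown_eq)
    qed
    then show ?thesis by blast
  qed
  ultimately have "dim (range e) + 1 = dim UNIV"
    using dim_insert[of k "range e"] dim_span[of "insert k (range e)"] by simp
  moreover have "dim U < dim UNIV" using U by (rule dim_less_dim_UNIV)
  ultimately have "e \<in> J scale U (dim UNIV - dim U - 1)"
    using \<open>e \<in> L_GL scale U\<close> by (simp add: J_iff_dim[OF U(1)])
  then show ?thesis by blast
qed

end

theorem lemma5p4:
  fixes scale :: "'f::{field,finite} \<Rightarrow> 'v::ab_group_add \<Rightarrow> 'v"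
    and Basis U :: "'v set"
    and n r :: nat
  assumes "finite_dimensional_vector_space scale Basis"
    and "vector_space.dim scale (UNIV :: 'v set) = n"
    and "module.subspace scale U"
    and "vector_space.dim scale U = r"
    and "U \<noteq> UNIV"
  shows "(\<forall>\<alpha> \<in> J scale U (n - r - 1).
            L_GL scale U = sg_generated map_mult (J scale U (n - r) \<union> {\<alpha>}))
         \<and> sg_rank map_mult (L_GL scale U) \<le> sg_rank map_mult (J scale U (n - r)) + 1"
proof -
  interpret finite_dimensional_vector_space scale Basis by fact
  note n = assms(2)[symmetric] and U = assms(3) and r = assms(4)[symmetric]
  have fin: "finite (UNIV :: 'v set)" by (rule finite_UNIV_if_finite_field) simp
  have top: "J scale U (n - r) = {\<alpha> \<in> L_GL scale U. inj \<alpha>}"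
    unfolding n r by (rule J_top[OF U])
  \<comment> \<open>Strictness guarantees that \<open>n - r - 1\<close> is a genuine difference of
    naturals, so that \<open>\<alpha>\<close> has corank exactly one.\<close>
  have "r < n" unfolding n r using U assms(5) by (rule dim_less_dim_UNIV)
  have gen: "L_GL scale U = sg_generated map_mult (J scale U (n - r) \<union> {\<alpha>})"
    if \<alpha>: "\<alpha> \<in> J scale U (n - r - 1)" for \<alpha>
    unfolding top
  proof (rule L_GL_eq_sg_generated[OF fin U])
    show "\<alpha> \<in> L_GL scale U" using \<alpha> by (simp add: J_def)
    show *: "dim (range \<alpha>) + 1 = dim UNIV"
      using \<alpha> \<open>r < n\<close> unfolding J_iff_dim[OF U] assms(2,4) by linarith
    show "\<not> inj \<alpha>"
      using * linear_inj_imp_surj[of \<alpha>] \<alpha> by (auto simp: J_def L_GL_def)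
  qed
  have fin_J: "finite (J scale U (n - r))"
    using finite_set_of_finite_funs[OF fin fin] by (auto intro: finite_subset[OF subset_UNIV])
  have closed: "map_mult a b \<in> J scale U (n - r)"
    if "a \<in> J scale U (n - r)" "b \<in> J scale U (n - r)" for a b
    using that L_GL_mult[of a scale U b] unfolding top by (auto simp: map_mult_def inj_compose)
  obtain G where G: "G \<subseteq> J scale U (n - r)" "finite G"
    "card G = sg_rank map_mult (J scale U (n - r))" "J scale U (n - r) = sg_generated map_mult G"
    by (rule sg_rank_attained[of "J scale U (n - r)" map_mult, OF fin_J closed])
  obtain \<alpha> where \<alpha>: "\<alpha> \<in> J scale U (n - r - 1)"
    using J_corank_one_nonempty[OF U assms(5)] unfolding n r by blast
  \<comment> \<open>A minimal generating set \<open>G\<close> of the units yields all of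
    \<open>J(n - r)\<close>, and with \<open>\<alpha>\<close> added this generates the whole
    semigroup.\<close>
  have "L_GL scale U = sg_generated map_mult (insert \<alpha> G)"
  proof
    have sub: "insert \<alpha> G \<subseteq> L_GL scale U" using G(1) \<alpha> by (auto simp: J_def)
    then show "sg_generated map_mult (insert \<alpha> G) \<subseteq> L_GL scale U"
      by (rule sg_generated_minimal) (rule L_GL_mult)
    have "J scale U (n - r) \<subseteq> sg_generated map_mult (insert \<alpha> G)"
      unfolding G(4)
      by (rule sg_generated_minimal)
        (auto intro: sg_generated_incl sg_generated_closed[of map_mult, OF map_mult_assoc])
    then show "L_GL scale U \<subseteq> sg_generated map_mult (insert \<alpha> G)"
      unfolding gen[OF \<alpha>]
      by (intro sg_generated_minimal)
        (auto intro: sg_generated_incl sg_generated_closed[of map_mult, OF map_mult_assoc])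
  qed
  then have "sg_rank map_mult (L_GL scale U) \<le> card (insert \<alpha> G)"
    using G(1,2) \<alpha> by (intro sg_rank_le_card) (auto simp: J_def)
  also have "\<dots> \<le> sg_rank map_mult (J scale U (n - r)) + 1"
    using G(2,3) by (simp add: card_insert_if)
  finally show ?thesis using gen by blast
qed

end
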